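(* Let $t,n$ be rational integers and let $\omega$ be a real quadratic irrational with $\omega^2-t\omega+n=0$. Let $h\ge 1$ and suppose that the continued fraction expansion of $\omega$ commences $\omega=[\,A,a_1,a_2,\ldots,a_h,(\omega+P)/Q\,]$, where $A$ is an integer, $a_1,\ldots,a_h$ are positive integers, and $(\omega+P)/Q$, with $P,Q$ integers, is the complete quotient following $a_h$. Define integers $p,p',q,q'$ by $$\begin{pmatrix} a_1 & 1\\ 1& 0\end{pmatrix}\cdots\begin{pmatrix} a_h & 1\\ 1& 0\end{pmatrix}=\begin{pmatrix} p & p'\\ q& q'\end{pmatrix}.$$ Put $k=A-t-P$, and let $T=t-2A$ and $N=A^2-tA+n$ be the trace and norm of $\omega-A$. Then there exist integers $K_1,K_2,L$ such that all of the following hold: $$P^2+tP+n=(-1)^{h+1}Q(q'^2-K_1p'),\qquad -(A+P)=(-1)^{h+1}(qq'-K_1p),$$ $$A^2-tA+n=(-1)^{h+1}(q'^2Q-K_2q),\qquad -(A+P)=(-1)^{h+1}(p'q'Q-K_2p),$$ $$K_2-K_1=kq',\qquad (-1)^{h+1}k=qq'-Lp',\qquad (-1)^{h+1}Q=q^2-Lp,\qquad L=q'Q-kq,$$ $$T=(-1)^h(K_1p-Lp'),\qquad N=(-1)^h(K_1q-Lq').$$ In particular the discriminant $t^2-4n=T^2-4N$ is a quadratic polynomial expression in $K_1$ and $L$ with coefficients determined by $a_1,\ldots,a_h$.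
   Context: Continued fraction notation: $[a_0]=a_0$ and $[a_0,a_1,\ldots,a_m]=a_0+1/[a_1,\ldots,a_m]$, where the last entry may be any real number (a complete quotient). The complete quotients $\alpha_{j}$ of $\alpha=[a_0,a_1,a_2,\ldots]$ are defined by $\alpha=[a_0,a_1,\ldots,a_{j-1},\alpha_{j}]$. For a quadratic irrational integer $\omega$, every complete quotient has the form $\omega_j=(\omega+P_j)/Q_j$ with $P_j,Q_j$ rational integers, $Q_j\ne 0$, and $Q_j$ divides $P_j^2+tP_j+n$; more precisely $P_{j+1}^2+tP_{j+1}+n=-Q_jQ_{j+1}$. Here $P=P_{h+1}$ and $Q=Q_{h+1}$. *)

theory Defs
  imports "HOL-Analysis.Analysis"
begin

text \<open>The value on the empty list is a dummy that is never used.\<close>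

fun cfrac_val :: "real list \<Rightarrow> real" where
  "cfrac_val [] = 0"
| "cfrac_val [x] = x"
| "cfrac_val (x # y # ys) = x + 1 / cfrac_val (y # ys)"

definition is_cfrac_expansion :: "real \<Rightarrow> (nat \<Rightarrow> int) \<Rightarrow> bool" where
  "is_cfrac_expansion \<alpha> a \<longleftrightarrow>
     (\<forall>j\<ge>1. a j > 0) \<and>
     (\<lambda>m. cfrac_val (map (\<lambda>i. real_of_int (a i)) [0..<Suc m])) \<longlonglongrightarrow> \<alpha>"

text \<open>
  \<open>is_complete_quotient \<alpha> a j x\<close> says that \<open>x\<close> is the complete quotient \<open>\<alpha>\<^sub>j\<close>, which follows
  the partial quotient of index \<open>j - 1\<close>.
\<close>

definition is_complete_quotient :: "real \<Rightarrow> (nat \<Rightarrow> int) \<Rightarrow> nat \<Rightarrow> real \<Rightarrow> bool" where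
  "is_complete_quotient \<alpha> a j x \<longleftrightarrow>
     is_cfrac_expansion \<alpha> a \<and>
     \<alpha> = cfrac_val (map (\<lambda>i. real_of_int (a i)) [0..<j] @ [x])"

definition cfrac_step :: "int \<Rightarrow> int ^ 2 ^ 2" where
  "cfrac_step c = vector [vector [c, 1], vector [1, 0]]"

text \<open>The product starts at index 1: the integer part \<open>a 0\<close> is not included.\<close>

primrec cfrac_matrix :: "(nat \<Rightarrow> int) \<Rightarrow> nat \<Rightarrow> int ^ 2 ^ 2" where
  "cfrac_matrix a 0 = mat 1"
| "cfrac_matrix a (Suc h) = cfrac_matrix a h ** cfrac_step (a (Suc h))"

end

theory Submission
  imports Defs
begin

text \<open>
  Writing \<open>\<omega> = A + (q x + q') / (p x + p')\<close> with \<open>x = (\<omega> + P) / Q\<close>, clearing denominators and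
  comparing the coefficients of \<open>1\<close> and \<open>\<omega>\<close> gives \<open>q = p' Q - k p\<close> and
  \<open>q (A + P) + q' Q = - p N\<close>. With \<open>p q' - p' q = (-1)^h\<close>, the two identities for \<open>T\<close> and \<open>N\<close> form an
  invertible linear system for \<open>K\<^sub>1\<close> and \<open>L\<close>, whose solution is \<open>K\<^sub>1 = q' T - p' N\<close>,
  \<open>L = q T - p N\<close>; all the other identities are then polynomial consequences.
\<close>

text \<open>Lets an induction on the length absorb the last partial quotient into the complete
  quotient after it.\<close>

lemma cfrac_val_merge_last:
  "cfrac_val (xs @ [c, x]) = cfrac_val (xs @ [c + 1 / x])"
proof (induction xs)
  case Nil
  show ?case by simp
next
  case (Cons y ys)
  then show ?case by (cases ys) auto
qed

lemma cfrac_matrix_Suc_entries: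
  "cfrac_matrix a (Suc h) $ i $ 1 = cfrac_matrix a h $ i $ 1 * a (Suc h) + cfrac_matrix a h $ i $ 2"
  "cfrac_matrix a (Suc h) $ i $ 2 = cfrac_matrix a h $ i $ 1"
  by (simp_all add: cfrac_step_def matrix_matrix_mult_def sum_2)

lemma det_cfrac_matrix: "det (cfrac_matrix a h) = (-1) ^ h"
proof (induction h)
  case 0
  show ?case by (simp add: det_I)
next
  case (Suc h)
  have "det (cfrac_step c) = -1" for c
    by (simp add: cfrac_step_def det_2)
  with Suc show ?case by (simp add: det_mul)
qed

text \<open>Since the product omits \<open>a 0\<close>, its second row gives the numerator and its
  first row the denominator of the value minus \<open>a 0\<close>. The multiplied-out form avoids
  proving the denominator nonzero; irrationality of \<open>x\<close> passes to each merged quotient,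
  so no step divides by zero.\<close>

lemma cfrac_val_cfrac_matrix:
  fixes x :: real
  assumes "x \<notin> \<rat>"
  shows "(cfrac_val (map (\<lambda>i. real_of_int (a i)) [0..<Suc h] @ [x]) - of_int (a 0)) *
           (of_int (cfrac_matrix a h $ 1 $ 1) * x + of_int (cfrac_matrix a h $ 1 $ 2)) =
         of_int (cfrac_matrix a h $ 2 $ 1) * x + of_int (cfrac_matrix a h $ 2 $ 2)"
  using assms
proof (induction h arbitrary: x)
  case 0
  then have "x \<noteq> 0" by auto
  then show ?case by (simp add: mat_def)
next
  case (Suc h)
  define y where "y = of_int (a (Suc h)) + 1 / x"
  have x0: "x \<noteq> 0" using Suc.prems by auto
  have "x = 1 / (y - of_int (a (Suc h)))" by (simp add: y_def)
  then have "y \<notin> \<rat>"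
    using Suc.prems by (metis Rats_1 Rats_diff Rats_divide Rats_of_int)
  note IH = Suc.IH[OF this]
  let ?v = "cfrac_val (map (\<lambda>i. real_of_int (a i)) [0..<Suc h] @ [y])"
  have v: "cfrac_val (map (\<lambda>i. real_of_int (a i)) [0..<Suc (Suc h)] @ [x]) = ?v"
    using cfrac_val_merge_last[of "map (\<lambda>i. real_of_int (a i)) [0..<Suc h]" "of_int (a (Suc h))" x]
    by (simp add: y_def)
  have xy: "x * y = of_int (a (Suc h)) * x + 1"
    using x0 by (simp add: y_def field_simps)
  \<comment> \<open>Both rows acquire the same factor \<open>x\<close>, so the multiplied-out
    identity is preserved.\<close>
  have row: "of_int (cfrac_matrix a (Suc h) $ i $ 1) * x + of_int (cfrac_matrix a (Suc h) $ i $ 2) =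
      x * (of_int (cfrac_matrix a h $ i $ 1) * y + of_int (cfrac_matrix a h $ i $ 2))" for i
    unfolding cfrac_matrix_Suc_entries of_int_add of_int_mult using xy by algebra
  show ?case unfolding v row using IH by algebra
qed

lemma irrational_linear_eq_0:
  fixes x :: real and u v :: int
  assumes "x \<notin> \<rat>" and "of_int u * x + of_int v = 0"
  shows "u = 0" and "v = 0"
proof -
  show "u = 0"
  proof (rule ccontr)
    assume "u \<noteq> 0"
    then have "x = - of_int v / of_int u"
      using assms(2) by (simp add: field_simps)
    then show False using assms(1) by auto
  qed
  then show "v = 0" using assms(2) by simp
qed

theorem mainTheorem2:
  fixes t n A P Q k T N p p' q q' :: int
    and \<omega> :: real and a :: "nat \<Rightarrow> int" and h :: nat
  assumes "\<omega> \<notin> \<rat>"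
    and "\<omega>\<^sup>2 - of_int t * \<omega> + of_int n = 0"
    and "h \<ge> 1"
    and "a 0 = A"
    and "Q \<noteq> 0"
    and "is_complete_quotient \<omega> a (h + 1) ((\<omega> + of_int P) / of_int Q)"
    and "cfrac_matrix a h = vector [vector [p, p'], vector [q, q']]"
    and "k = A - t - P"
    and "T = t - 2 * A"
    and "N = A\<^sup>2 - t * A + n"
  shows "\<exists>K\<^sub>1 K\<^sub>2 L :: int.
      P\<^sup>2 + t * P + n = (-1) ^ (h + 1) * (Q * (q'\<^sup>2 - K\<^sub>1 * p')) \<and>
      - (A + P) = (-1) ^ (h + 1) * (q * q' - K\<^sub>1 * p) \<and>
      A\<^sup>2 - t * A + n = (-1) ^ (h + 1) * (q'\<^sup>2 * Q - K\<^sub>2 * q) \<and>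
      - (A + P) = (-1) ^ (h + 1) * (p' * q' * Q - K\<^sub>2 * p) \<and>
      K\<^sub>2 - K\<^sub>1 = k * q' \<and>
      (-1) ^ (h + 1) * k = q * q' - L * p' \<and>
      (-1) ^ (h + 1) * Q = q\<^sup>2 - L * p \<and>
      L = q' * Q - k * q \<and>
      T = (-1) ^ h * (K\<^sub>1 * p - L * p') \<and>
      N = (-1) ^ h * (K\<^sub>1 * q - L * q') \<and>
      t\<^sup>2 - 4 * n = T\<^sup>2 - 4 * N \<and>
      t\<^sup>2 - 4 * n =
        p\<^sup>2 * K\<^sub>1\<^sup>2 + (- 2 * p * p') * (K\<^sub>1 * L) + p'\<^sup>2 * L\<^sup>2
        + (- 4 * (-1) ^ h * q) * K\<^sub>1 + (4 * (-1) ^ h * q') * L"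
proof -
  define x where "x = (\<omega> + of_int P) / of_int Q"
  have Qx: "of_int Q * x = \<omega> + of_int P"
    using \<open>Q \<noteq> 0\<close> by (simp add: x_def)
  then have "\<omega> = of_int Q * x - of_int P" by simp
  then have "x \<notin> \<rat>"
    using assms(1) by (metis Rats_diff Rats_mult Rats_of_int)
  have entries: "cfrac_matrix a h $ 1 $ 1 = p" "cfrac_matrix a h $ 1 $ 2 = p'"
    "cfrac_matrix a h $ 2 $ 1 = q" "cfrac_matrix a h $ 2 $ 2 = q'"
    by (simp_all add: assms(7))
  have "\<omega> = cfrac_val (map (\<lambda>i. real_of_int (a i)) [0..<Suc h] @ [x])"
    using assms(6) by (simp add: is_complete_quotient_def x_def)
  with cfrac_val_cfrac_matrix[OF \<open>x \<notin> \<rat>\<close>, of a h]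
  have mobius: "(\<omega> - of_int A) * (of_int p * x + of_int p') = of_int q * x + of_int q'"
    by (simp only: entries assms(4))
  define e :: int where "e = (-1) ^ h"
  have det: "p * q' - p' * q = e"
    using det_cfrac_matrix[of a h] by (simp add: det_2 entries e_def)
  have e2: "e * e = 1"
    by (simp add: e_def flip: power_mult_distrib)
  \<comment> \<open>This is \<open>mobius\<close> times \<open>Q\<close>, with \<open>Q * x\<close>
    replaced by \<omega> + P and the square of \<omega> reduced by its quadratic equation.\<close>
  have "of_int (p' * Q - k * p - q) * \<omega> + of_int (- p * n - A * (p * P + p' * Q) - q * P - q' * Q) = 0"
    using mobius Qx assms(2) unfolding assms(8) of_int_add of_int_mult of_int_diff of_int_minus
    by algebra
  note lin = irrational_linear_eq_0[OF assms(1) this]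
  have r1: "q = p' * Q - k * p" using lin(1) by simp
  have r2: "q * (A + P) + q' * Q = - p * N"
    using r1 lin(2) assms(8,10) by algebra
  have T: "T = - (A + P) - k" using assms(8,9) by simp
  define K1 where "K1 = q' * T - p' * N"
  define K2 where "K2 = K1 + k * q'"
  define L where "L = q * T - p * N"
  have L: "L = q' * Q - k * q"
    using r2 T unfolding L_def by algebra
  \<comment> \<open>Cramer's rule: the combination equals \<open>T\<close> times the determinant
    \<open>e\<close>, which is its own inverse.\<close>
  have eT: "T = e * (K1 * p - L * p')"
  proof -
    have "K1 * p - L * p' = e * T"
      unfolding K1_def L_def det[symmetric] by algebra
    then show ?thesis using e2 by (simp flip: mult.assoc)
  qed
  have eN: "N = e * (K1 * q - L * q')"
  proof -
    have "K1 * q - L * q' = e * N"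
      unfolding K1_def L_def det[symmetric] by algebra
    then show ?thesis using e2 by (simp flip: mult.assoc)
  qed
  \<comment> \<open>The left side and \<open>N\<close> are the values of X^2 + t X + n at P and -A,
    so their difference has the factor A + P.\<close>
  have "P\<^sup>2 + t * P + n = N - (A + P) * k"
    using assms(8,10) by algebra
  also have "\<dots> = - e * (Q * (q'\<^sup>2 - K1 * p'))"
    using r1 r2 det e2 T unfolding K1_def by algebra
  finally have g1: "P\<^sup>2 + t * P + n = - e * (Q * (q'\<^sup>2 - K1 * p'))" .
  have g2: "- (A + P) = - e * (q * q' - K1 * p)"
    using r1 r2 det e2 T unfolding K1_def by algebra
  \<comment> \<open>The shift \<open>k * q'\<close> in \<open>K2\<close> turns the bracket into
    \<open>q' * L - K1 * q\<close>, which reduces this to \<open>eN\<close>.\<close>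
  have g3: "N = - e * (q'\<^sup>2 * Q - K2 * q)"
    using eN L unfolding K2_def by algebra
  have g4: "- (A + P) = - e * (p' * q' * Q - K2 * p)"
    using g2 r1 unfolding K2_def by algebra
  \<comment> \<open>Here and in \<open>g6\<close>, inserting \<open>L\<close> and then
    \<open>r1\<close> leaves the determinant as a factor.\<close>
  have g5: "- e * k = q * q' - L * p'"
    using L r1 det by algebra
  have g6: "- e * Q = q\<^sup>2 - L * p"
    using L r1 det by algebra
  have disc: "t\<^sup>2 - 4 * n = T\<^sup>2 - 4 * N"
    using assms(9,10) by algebra
  \<comment> \<open>Squaring \<open>T\<close> removes the sign \<open>e\<close>, which survives only
    in the linear terms coming from \<open>N\<close>.\<close>
  have quad: "t\<^sup>2 - 4 * n =
        p\<^sup>2 * K1\<^sup>2 + (- 2 * p * p') * (K1 * L) + p'\<^sup>2 * L\<^sup>2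
        + (- 4 * e * q) * K1 + (4 * e * q') * L"
    using disc eT eN e2 by algebra
  have e_Suc: "(-1) ^ (h + 1) = - e" by (simp add: e_def)
  show ?thesis
    unfolding e_Suc e_def[symmetric]
    using g1 g2 g3 g4 g5 g6 L eT eN disc quad
    by (intro exI[of _ K1] exI[of _ K2] exI[of _ L]) (simp add: K2_def assms(10))
qed

end
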